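(* For any positive integer $r$, the probability that a uniform random permutation $\sigma\in S_n$ is self-overlapping satisfies, as $n\to\infty$, \[ \mathbb{P}(\sigma\text{ is self-overlapping})=\sum_{k=1}^{r-1}\frac{\mathfrak{n}_k}{n^{\underline{2k}}}+O\left(\frac{1}{n^{2r}}\right), \] where $n^{\underline{k}}=n(n-1)\ldots(n-k+1)$ are the falling factorials.
   Context: $S_n$ denotes the set of permutations $\sigma=\sigma_1\ldots\sigma_n$ of $\{1,\ldots,n\}$. Two sequences of distinct integers $\pi_1\ldots\pi_k$ and $\tau_1\ldots\tau_k$ are isomorphic if $\pi_i>\pi_j\Leftrightarrow\tau_i>\tau_j$ for all $i,j$. A permutation $\sigma\in S_n$, $n\geqslant1$, is self-overlapping if there is an integer $1\leqslant k<n$ such that: (1) $\{1,\ldots,k\}$ is invariant under $\sigma$; (2) $\{n-k+1,\ldots,n\}$ is invariant under $\sigma$; (3) $\sigma_1\ldots\sigma_k$ and $\sigma_{n-k+1}\ldots\sigma_n$ are isomorphic. Otherwise $\sigma$ is non-self-overlapping. For $k\geqslant1$, $\mathfrak{n}_k$ denotes the number of non-self-overlapping permutations in $S_k$. The integer $r$ is fixed as $n\to\infty$, so the implied constant may depend on $r$. *)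

theory Defs
  imports
    "HOL-Probability.Probability"
    "HOL-Combinatorics.Permutations"
    "HOL-Library.Landau_Symbols"
begin

definition Sym :: "nat \<Rightarrow> (nat \<Rightarrow> nat) set" where
  "Sym n = {\<sigma>. \<sigma> permutes {1..n}}"

text \<open>Isomorphism of two sequences of distinct numbers of the same length. Lists are indexed
  from 0.\<close>

definition isomorphic_seqs :: "nat list \<Rightarrow> nat list \<Rightarrow> bool" where
  "isomorphic_seqs xs ys \<longleftrightarrow>
     distinct xs \<and> distinct ys \<and> length xs = length ys \<and>
     (\<forall>i<length xs. \<forall>j<length xs. xs ! i > xs ! j \<longleftrightarrow> ys ! i > ys ! j)"

text \<open>Intended for \<open>\<sigma> \<in> Sym n\<close>. Note that \<open>[a..<b + 1]\<close> is the list \<open>a, \<dots>, b\<close>, so the two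
  sequences compared are \<open>\<sigma> 1, \<dots>, \<sigma> k\<close> and \<open>\<sigma> (n - k + 1), \<dots>, \<sigma> n\<close>.\<close>

definition self_overlapping :: "nat \<Rightarrow> (nat \<Rightarrow> nat) \<Rightarrow> bool" where
  "self_overlapping n \<sigma> \<longleftrightarrow>
     (\<exists>k. 1 \<le> k \<and> k < n \<and>
        \<sigma> ` {1..k} \<subseteq> {1..k} \<and>
        \<sigma> ` {n - k + 1..n} \<subseteq> {n - k + 1..n} \<and>
        isomorphic_seqs (map \<sigma> [1..<k + 1]) (map \<sigma> [n - k + 1..<n + 1]))"

definition num_non_self_overlapping :: "nat \<Rightarrow> nat" where
  "num_non_self_overlapping k = card {\<sigma> \<in> Sym k. \<not> self_overlapping k \<sigma>}"

text \<open>Taken over the reals, so there is no truncated subtraction.\<close>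

definition falling_factorial :: "real \<Rightarrow> nat \<Rightarrow> real" where
  "falling_factorial x k = (\<Prod>i<k. x - real i)"

end

theory Submission
  imports Defs
begin

text \<open>
  A self-overlapping permutation may overlap itself at several lengths \<open>k\<close>, but exactly one of
  them is primitive: the prefix \<open>\<sigma> 1, \<dots>, \<sigma> k\<close> is itself non-self-overlapping. It is the
  smallest one. This rests on two closure properties, both easy once order-isomorphism of the two
  invariant ends is recognised as a translation, \<open>\<sigma> (i + (n - k)) = \<sigma> i + (n - k)\<close>.
  Overlaps nest: the overlaps of \<open>\<sigma>\<close> shorter than a given overlap \<open>k\<close> are those of its prefix of
  length \<open>k\<close> (\<open>overlaps_at_nested_iff\<close>). And if the prefix and suffix of length \<open>k\<close> intersect,
  the size of their intersection is again the length of an overlap (\<open>overlaps_at_shorten\<close>), so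
  the smallest overlap has \<open>2 * k \<le> n\<close>.

  A permutation with primitive overlap \<open>k\<close> then amounts to a free choice of a
  non-self-overlapping permutation for the two ends and any permutation of the \<open>n - 2 * k\<close> middle
  points. Dividing the number of choices by \<open>n!\<close> gives an exact formula for the probability, the
  sum of the theorem extended to all \<open>k \<le> n div 2\<close> (\<open>prob_self_overlapping\<close>).

  What remains is to see that the terms with \<open>k \<ge> r\<close> contribute \<open>O(1 / n ^ (2 * r))\<close>. Each of the
  boundedly many with \<open>r \<le> k \<le> 2 * r\<close> is \<open>O(1 / n ^ (2 * k))\<close>. For larger \<open>k\<close> the estimate
  \<open>k! (n - 2k)! \<le> (n - k)!\<close> bounds the term by the reciprocal of the falling factorial of order
  \<open>2 * r + 1\<close>, hence by \<open>O(1 / n ^ (2 * r + 1))\<close>; the one spare factor of \<open>n\<close> pays for the at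
  most \<open>n\<close> terms of this kind.
\<close>

section \<open>Overlaps as translations\<close>

text \<open>
  The suffix is described by the prefix through translation, which makes its invariance and the
  order-isomorphism one equation; composing and cancelling translations then replaces
  arguments about relative order. \<open>overlap_conditions_iff_overlaps_at\<close> shows the equivalence.
\<close>

definition overlaps_at :: "nat \<Rightarrow> nat \<Rightarrow> (nat \<Rightarrow> nat) \<Rightarrow> bool" where
  "overlaps_at n k \<sigma> \<longleftrightarrow>
     \<sigma> ` {1..k} \<subseteq> {1..k} \<and> (\<forall>i\<in>{1..k}. \<sigma> (i + (n - k)) = \<sigma> i + (n - k))"

lemma bij_value_eq_rank:
  fixes f :: "nat \<Rightarrow> nat"
  assumes "bij_betw f {1..k} {1..k}" and "i \<in> {1..k}"
  shows "f i = card {j \<in> {1..k}. f j \<le> f i}"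
proof -
  have img: "f ` {1..k} = {1..k}" and inj: "inj_on f {1..k}"
    using assms(1) by (auto simp: bij_betw_def)
  have "f i \<le> k" using img assms(2) by fastforce
  have "f ` {j \<in> {1..k}. f j \<le> f i} = {1..f i}"
  proof (intro equalityI subsetI)
    fix y assume "y \<in> f ` {j \<in> {1..k}. f j \<le> f i}"
    then obtain j where "j \<in> {1..k}" "f j \<le> f i" "y = f j" by blast
    moreover have "f j \<in> {1..k}" using img calculation(1) by blast
    ultimately show "y \<in> {1..f i}" by simp
  next
    fix y assume y: "y \<in> {1..f i}"
    then have "y \<in> f ` {1..k}" using \<open>f i \<le> k\<close> img by auto
    then show "y \<in> f ` {j \<in> {1..k}. f j \<le> f i}" using y by auto
  qed
  moreover have "card (f ` {j \<in> {1..k}. f j \<le> f i}) = card {j \<in> {1..k}. f j \<le> f i}"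
    by (rule card_image) (auto intro: inj_on_subset[OF inj])
  ultimately show ?thesis by simp
qed

text \<open>The value at \<open>i\<close> is its rank, and ranks only depend on the relative order.\<close>

lemma order_isomorphic_bij_eq:
  fixes f g :: "nat \<Rightarrow> nat"
  assumes "bij_betw f {1..k} {1..k}" and "bij_betw g {1..k} {1..k}"
    and "\<And>i j. i \<in> {1..k} \<Longrightarrow> j \<in> {1..k} \<Longrightarrow> f i > f j \<longleftrightarrow> g i > g j"
    and "i \<in> {1..k}"
  shows "f i = g i"
proof -
  have "{j \<in> {1..k}. f j \<le> f i} = {j \<in> {1..k}. g j \<le> g i}"
    using assms(3,4) by (auto simp: not_less[symmetric])
  then show ?thesis
    using bij_value_eq_rank[OF assms(1,4)] bij_value_eq_rank[OF assms(2,4)] by simp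
qed

lemma isomorphic_seqs_prefix_suffix_iff:
  assumes "inj_on \<sigma> {1..n}" and "k \<le> n"
  shows "isomorphic_seqs (map \<sigma> [1..<k + 1]) (map \<sigma> [n - k + 1..<n + 1]) \<longleftrightarrow>
    (\<forall>i\<in>{1..k}. \<forall>j\<in>{1..k}. \<sigma> i > \<sigma> j \<longleftrightarrow> \<sigma> (i + (n - k)) > \<sigma> (j + (n - k)))"
proof -
  have "distinct (map \<sigma> [1..<k + 1])" "distinct (map \<sigma> [n - k + 1..<n + 1])"
    using assms by (auto simp: distinct_map intro!: inj_on_subset[OF assms(1)])
  moreover have "map \<sigma> [1..<k + 1] ! i = \<sigma> (i + 1)"
    "map \<sigma> [n - k + 1..<n + 1] ! i = \<sigma> (i + 1 + (n - k))" if "i < k" for i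
    using that assms(2) by (simp_all add: nth_map nth_upt add.commute del: upt_Suc)
  ultimately have "isomorphic_seqs (map \<sigma> [1..<k + 1]) (map \<sigma> [n - k + 1..<n + 1]) \<longleftrightarrow>
    (\<forall>i<k. \<forall>j<k. \<sigma> (i+1) > \<sigma> (j+1) \<longleftrightarrow> \<sigma> (i + 1 + (n - k)) > \<sigma> (j + 1 + (n - k)))"
    using assms(2) by (simp add: isomorphic_seqs_def del: upt_Suc)
  also have "\<dots> \<longleftrightarrow> (\<forall>i\<in>{1..k}. \<forall>j\<in>{1..k}. \<sigma> i > \<sigma> j \<longleftrightarrow> \<sigma> (i + (n - k)) > \<sigma> (j + (n - k)))"
  proof -
    have "{1..k} = Suc ` {..<k}" by (simp add: image_Suc_lessThan)
    then show ?thesis by auto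
  qed
  finally show ?thesis .
qed

text \<open>
  Translated back to \<open>{1..k}\<close>, the suffix becomes a permutation of \<open>{1..k}\<close> order-isomorphic to
  the prefix, hence equal to it.
\<close>

lemma overlap_conditions_iff_overlaps_at:
  assumes inj: "inj_on \<sigma> {1..n}" and "k \<le> n"
  shows "\<sigma> ` {1..k} \<subseteq> {1..k} \<and> \<sigma> ` {n - k + 1..n} \<subseteq> {n - k + 1..n} \<and>
      isomorphic_seqs (map \<sigma> [1..<k + 1]) (map \<sigma> [n - k + 1..<n + 1])
    \<longleftrightarrow> overlaps_at n k \<sigma>" (is "?L \<longleftrightarrow> _")
proof
  assume L: ?L
  define g where "g i = \<sigma> (i + (n - k)) - (n - k)" for i
  have g: "\<sigma> (i + (n - k)) = g i + (n - k) \<and> g i \<in> {1..k}" if "i \<in> {1..k}" for i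
  proof -
    have "i + (n - k) \<in> {n - k + 1..n}" using that \<open>k \<le> n\<close> by auto
    then have "\<sigma> (i + (n - k)) \<in> {n - k + 1..n}" using L by blast
    then show ?thesis using \<open>k \<le> n\<close> by (auto simp: g_def)
  qed
  have f_bij: "bij_betw \<sigma> {1..k} {1..k}"
    using L inj_on_subset[OF inj, of "{1..k}"] \<open>k \<le> n\<close>
    by (auto simp: bij_betw_def endo_inj_surj)
  have "inj_on g {1..k}"
  proof (rule inj_onI)
    fix i j assume ij: "i \<in> {1..k}" "j \<in> {1..k}" "g i = g j"
    then have "\<sigma> (i + (n - k)) = \<sigma> (j + (n - k))" using g by metis
    moreover have "i + (n - k) \<in> {1..n}" "j + (n - k) \<in> {1..n}" using ij \<open>k \<le> n\<close> by auto
    ultimately have "i + (n - k) = j + (n - k)" by (rule inj_onD[OF inj])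
    then show "i = j" by simp
  qed
  moreover have "g ` {1..k} \<subseteq> {1..k}" using g by blast
  ultimately have "bij_betw g {1..k} {1..k}" by (simp add: bij_betw_def endo_inj_surj)
  then have "\<sigma> i = g i" if "i \<in> {1..k}" for i
  proof (rule order_isomorphic_bij_eq[OF f_bij _ _ that])
    fix i j assume ij: "i \<in> {1..k}" "j \<in> {1..k}"
    have "\<sigma> i > \<sigma> j \<longleftrightarrow> \<sigma> (i + (n - k)) > \<sigma> (j + (n - k))"
      using L ij isomorphic_seqs_prefix_suffix_iff[OF assms] by blast
    then show "\<sigma> i > \<sigma> j \<longleftrightarrow> g i > g j" using g ij by simp
  qed
  then show "overlaps_at n k \<sigma>" using L g by (auto simp: overlaps_at_def)
next
  assume ov: "overlaps_at n k \<sigma>"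
  have "\<sigma> x \<in> {n - k + 1..n}" if "x \<in> {n - k + 1..n}" for x
  proof -
    have i: "x - (n - k) \<in> {1..k}" "x = x - (n - k) + (n - k)" using that by auto
    have "\<sigma> (x - (n - k)) \<in> {1..k}" using ov i(1) unfolding overlaps_at_def by blast
    moreover have "\<sigma> x = \<sigma> (x - (n - k)) + (n - k)"
      using ov i by (metis overlaps_at_def)
    ultimately show ?thesis using \<open>k \<le> n\<close> by auto
  qed
  then show ?L
    using ov isomorphic_seqs_prefix_suffix_iff[OF assms] by (auto simp: overlaps_at_def)
qed

lemma self_overlapping_iff_overlaps_at:
  assumes "inj_on \<sigma> {1..n}"
  shows "self_overlapping n \<sigma> \<longleftrightarrow> (\<exists>k. 1 \<le> k \<and> k < n \<and> overlaps_at n k \<sigma>)"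
  unfolding self_overlapping_def
  using overlap_conditions_iff_overlaps_at[OF assms] by (meson less_imp_le)

section \<open>The unique primitive overlap\<close>

text \<open>
  Moving by \<open>n - j\<close> is moving by \<open>k - j\<close> inside the prefix of length \<open>k\<close> and then by \<open>n - k\<close>,
  and the second step commutes with \<open>\<sigma>\<close> because \<open>k\<close> is an overlap.
\<close>

lemma overlaps_at_nested_iff:
  assumes ov: "overlaps_at n k \<sigma>" and "j \<le> k" "k \<le> n"
  shows "overlaps_at n j \<sigma> \<longleftrightarrow> overlaps_at k j \<sigma>"
proof -
  have "\<sigma> (i + (n - j)) = \<sigma> (i + (k - j)) + (n - k)" if "i \<in> {1..j}" for i
  proof -
    have "i + (k - j) \<in> {1..k}" using that assms(2) by auto
    moreover have "i + (n - j) = i + (k - j) + (n - k)" using assms(2,3) by simp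
    ultimately show ?thesis using ov by (metis overlaps_at_def)
  qed
  moreover have "\<sigma> i + (n - j) = \<sigma> i + (k - j) + (n - k)" for i
    using assms(2,3) by simp
  ultimately show ?thesis by (auto simp: overlaps_at_def)
qed

text \<open>
  The prefix and the suffix of length \<open>k\<close> meet in \<open>{n - k + 1..k}\<close>, an invariant interval of
  length \<open>2 * k - n\<close>. Translating it by \<open>n - k\<close> to the left and to the right gives the two ends
  of that length, so they are translates of each other by \<open>2 * (n - k)\<close>.
\<close>

lemma overlaps_at_shorten:
  assumes ov: "overlaps_at n k \<sigma>" and "n < 2 * k" "k \<le> n"
  shows "overlaps_at n (2 * k - n) \<sigma>"
  unfolding overlaps_at_def
proof (intro conjI subsetI ballI)
  define d where "d = n - k"
  have d: "n = k + d" "d < k" using assms by (auto simp: d_def)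
  have inv: "\<sigma> i \<in> {1..k}" and sh: "\<sigma> (i + d) = \<sigma> i + d" if "i \<in> {1..k}" for i
    using ov that unfolding overlaps_at_def d_def by blast+
  {
    fix y assume "y \<in> \<sigma> ` {1..2 * k - n}"
    then obtain i where i: "y = \<sigma> i" "1 \<le> i" "i + d \<le> k" using d by auto
    have "\<sigma> i + d \<le> k" "1 \<le> \<sigma> i" using inv[of "i + d"] inv[of i] sh[of i] i by auto
    then show "y \<in> {1..2 * k - n}" using i d by auto
  next
    fix i assume "i \<in> {1..2 * k - n}"
    then have i: "1 \<le> i" "i + d \<le> k" using d by auto
    have "\<sigma> (i + d + d) = \<sigma> i + d + d" using sh[of "i + d"] sh[of i] i by auto
    moreover have "n - (2 * k - n) = d + d" using d by simp
    ultimately show "\<sigma> (i + (n - (2 * k - n))) = \<sigma> i + (n - (2 * k - n))"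
      by (simp add: add.assoc)
  }
qed

text \<open>
  The witness is the smallest overlap: an overlap of its prefix would, by nesting, be a smaller
  overlap of \<open>\<sigma>\<close>, and if its two ends intersected, so would the size of their intersection be.
\<close>

lemma self_overlapping_iff_primitive_overlap:
  assumes inj: "inj_on \<sigma> {1..n}"
  shows "self_overlapping n \<sigma> \<longleftrightarrow>
    (\<exists>k\<in>{1..n div 2}. overlaps_at n k \<sigma> \<and> \<not> self_overlapping k \<sigma>)"
proof
  assume "self_overlapping n \<sigma>"
  then have ex: "\<exists>k. 1 \<le> k \<and> k < n \<and> overlaps_at n k \<sigma>"
    using self_overlapping_iff_overlaps_at[OF inj] by simp
  define k where "k = (LEAST k. 1 \<le> k \<and> k < n \<and> overlaps_at n k \<sigma>)"
  have k: "1 \<le> k" "k < n" "overlaps_at n k \<sigma>"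
    using LeastI_ex[OF ex] by (auto simp: k_def)
  have least: "k \<le> j" if "1 \<le> j" "j < n" "overlaps_at n j \<sigma>" for j
    unfolding k_def by (rule Least_le) (use that in blast)
  have "2 * k \<le> n"
  proof (rule ccontr)
    assume "\<not> 2 * k \<le> n"
    then have "overlaps_at n (2 * k - n) \<sigma>" using k by (intro overlaps_at_shorten) auto
    then have "k \<le> 2 * k - n" using \<open>\<not> 2 * k \<le> n\<close> k by (intro least) auto
    then show False using k by linarith
  qed
  moreover have "\<not> self_overlapping k \<sigma>"
  proof
    assume "self_overlapping k \<sigma>"
    moreover have "inj_on \<sigma> {1..k}" using k by (auto intro: inj_on_subset[OF inj])
    ultimately obtain j where j: "1 \<le> j" "j < k" "overlaps_at k j \<sigma>"
      by (auto simp: self_overlapping_iff_overlaps_at)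
    then have "overlaps_at n j \<sigma>" using overlaps_at_nested_iff[OF k(3), of j] k by simp
    then show False using least[of j] j k by simp
  qed
  ultimately show "\<exists>k\<in>{1..n div 2}. overlaps_at n k \<sigma> \<and> \<not> self_overlapping k \<sigma>"
    using k by auto
next
  assume "\<exists>k\<in>{1..n div 2}. overlaps_at n k \<sigma> \<and> \<not> self_overlapping k \<sigma>"
  then obtain k where "k \<in> {1..n div 2}" "overlaps_at n k \<sigma>" by blast
  then have "1 \<le> k \<and> k < n \<and> overlaps_at n k \<sigma>" by auto
  then show "self_overlapping n \<sigma>" using self_overlapping_iff_overlaps_at[OF inj] by blast
qed

text \<open>
  By nesting, the smaller of two overlaps is an overlap of the prefix given by the larger, which
  is then self-overlapping.
\<close>

lemma primitive_overlap_unique: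
  assumes inj: "inj_on \<sigma> {1..n}" and "1 \<le> j" "1 \<le> k" "j \<le> n" "k \<le> n"
    and "overlaps_at n j \<sigma>" "\<not> self_overlapping j \<sigma>"
    and "overlaps_at n k \<sigma>" "\<not> self_overlapping k \<sigma>"
  shows "j = k"
proof -
  have no_less: False if "j < k" "1 \<le> j" "k \<le> n" "overlaps_at n j \<sigma>"
    "overlaps_at n k \<sigma>" "\<not> self_overlapping k \<sigma>" for j k
  proof -
    have "overlaps_at k j \<sigma>" using overlaps_at_nested_iff[of n k \<sigma> j] that by simp
    moreover have "inj_on \<sigma> {1..k}" using that(3) by (auto intro: inj_on_subset[OF inj])
    ultimately show False using that self_overlapping_iff_overlaps_at[of \<sigma> k] by blast
  qed
  show ?thesis
    using no_less[of j k] no_less[of k j] assms by (metis linorder_neqE_nat)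
qed

section \<open>Counting by primitive overlap\<close>

definition glue :: "nat \<Rightarrow> nat \<Rightarrow> (nat \<Rightarrow> nat) \<Rightarrow> (nat \<Rightarrow> nat) \<Rightarrow> nat \<Rightarrow> nat" where
  "glue n k \<tau> \<rho> x =
     (if x \<in> {1..k} then \<tau> x
      else if x \<in> {n - k + 1..n} then \<tau> (x - (n - k)) + (n - k)
      else \<rho> x)"

text \<open>
  This makes \<open>self_overlapping k \<sigma>\<close> meaningful for a permutation \<open>\<sigma>\<close> of a larger interval: it
  speaks of the prefix of length \<open>k\<close>.
\<close>

lemma self_overlapping_cong:
  assumes "\<And>x. x \<in> {1..k} \<Longrightarrow> \<sigma> x = \<tau> x" "inj_on \<tau> {1..k}"
  shows "self_overlapping k \<sigma> \<longleftrightarrow> self_overlapping k \<tau>"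
proof -
  have "inj_on \<sigma> {1..k}" using assms inj_on_cong[of "{1..k}" \<sigma> \<tau>] by blast
  moreover have "overlaps_at k j \<sigma> \<longleftrightarrow> overlaps_at k j \<tau>" if "j < k" for j
  proof -
    have "\<sigma> i = \<tau> i \<and> \<sigma> (i + (k - j)) = \<tau> (i + (k - j))" if "i \<in> {1..j}" for i
      using that \<open>j < k\<close> by (intro conjI assms(1)) auto
    then show ?thesis unfolding overlaps_at_def image_subset_iff by simp
  qed
  ultimately show ?thesis using assms(2) by (auto simp: self_overlapping_iff_overlaps_at)
qed

context
  fixes n k :: nat
  assumes half: "2 * k \<le> n"
begin

lemma block_cases:
  assumes "x \<in> {1..n}"
  obtains (prefix) "x \<in> {1..k}"
    | (suffix) y where "y \<in> {1..k}" "x = y + (n - k)"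
    | (middle) "x \<in> {k + 1..n - k}"
proof -
  consider "x \<le> k" | "k < x" "x \<le> n - k" | "n - k < x" by linarith
  then show thesis
  proof cases
    case 3
    then have "x - (n - k) \<in> {1..k}" "x = x - (n - k) + (n - k)" using assms by auto
    then show thesis by (rule suffix)
  qed (use assms prefix middle in auto)
qed

lemma glue_prefix: "x \<in> {1..k} \<Longrightarrow> glue n k \<tau> \<rho> x = \<tau> x"
  by (simp add: glue_def)

lemma glue_suffix:
  assumes "x \<in> {1..k}"
  shows "glue n k \<tau> \<rho> (x + (n - k)) = \<tau> x + (n - k)"
proof -
  have "x + (n - k) \<notin> {1..k}" "x + (n - k) \<in> {n - k + 1..n}" using assms half by auto
  then show ?thesis by (simp only: glue_def if_True if_False add_diff_cancel_right')
qed

lemma glue_middle: "x \<in> {k + 1..n - k} \<Longrightarrow> glue n k \<tau> \<rho> x = \<rho> x"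
  by (simp add: glue_def)

lemma glue_outside:
  assumes "x \<notin> {1..n}"
  shows "glue n k \<tau> \<rho> x = \<rho> x"
proof -
  have "x \<notin> {1..k}" "x \<notin> {n - k + 1..n}" using assms half by auto
  then show ?thesis by (simp only: glue_def if_False)
qed

lemmas glue_simps = glue_prefix glue_suffix glue_middle

lemma glue_permutes:
  assumes \<tau>: "\<tau> permutes {1..k}" and \<rho>: "\<rho> permutes {k + 1..n - k}"
  shows "glue n k \<tau> \<rho> permutes {1..n}"
proof (rule bij_imp_permutes)
  have t: "\<tau> x \<in> {1..k}" if "x \<in> {1..k}" for x using permutes_in_image[OF \<tau>] that by blast
  have r: "\<rho> x \<in> {k + 1..n - k}" if "x \<in> {k + 1..n - k}" for x
    using permutes_in_image[OF \<rho>] that by blast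
  have "glue n k (inv \<tau>) (inv \<rho>) (glue n k \<tau> \<rho> x) = x" if "x \<in> {1..n}" for x
    using that
  proof (cases x rule: block_cases)
    case prefix
    then show ?thesis using t[OF prefix] by (simp only: glue_simps permutes_inverses(2)[OF \<tau>])
  next
    case (suffix y)
    show ?thesis unfolding suffix(2)
      using suffix(1) t[OF suffix(1)] by (simp only: glue_simps permutes_inverses(2)[OF \<tau>])
  next
    case middle
    then show ?thesis using r[OF middle] by (simp only: glue_simps permutes_inverses(2)[OF \<rho>])
  qed
  \<comment> \<open>Gluing the inverses inverts the glued map, block by block.\<close>
  then have "inj_on (glue n k \<tau> \<rho>) {1..n}" by (rule inj_on_inverseI)
  moreover have "glue n k \<tau> \<rho> x \<in> {1..n}" if "x \<in> {1..n}" for x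
    using that
  proof (cases x rule: block_cases)
    case prefix
    then show ?thesis using t[OF prefix] half by (simp add: glue_prefix)
  next
    case (suffix y)
    show ?thesis
      unfolding suffix(2) glue_suffix[OF suffix(1)] using t[OF suffix(1)] half by auto
  next
    case middle
    show ?thesis unfolding glue_middle[OF middle] using r[OF middle] by auto
  qed
  then have "glue n k \<tau> \<rho> ` {1..n} \<subseteq> {1..n}" by blast
  ultimately show "bij_betw (glue n k \<tau> \<rho>) {1..n} {1..n}"
    by (simp add: bij_betw_def endo_inj_surj)
next
  fix x assume x: "x \<notin> {1..n}"
  then have "x \<notin> {k + 1..n - k}" by auto
  then show "glue n k \<tau> \<rho> x = x"
    unfolding glue_outside[OF x] by (rule permutes_not_in[OF \<rho>])
qed

lemma overlaps_at_glue:
  assumes "\<tau> permutes {1..k}"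
  shows "overlaps_at n k (glue n k \<tau> \<rho>)"
  using permutes_image[OF assms] by (simp add: overlaps_at_def glue_prefix glue_suffix)

lemma restrict_blocks_permute:
  assumes \<sigma>: "\<sigma> permutes {1..n}" and ov: "overlaps_at n k \<sigma>"
  shows "restrict_id \<sigma> {1..k} permutes {1..k}"
    and "restrict_id \<sigma> {k + 1..n - k} permutes {k + 1..n - k}"
proof -
  have inj: "inj_on \<sigma> A" for A using permutes_inj_on[OF \<sigma>] .
  have "\<sigma> ` {1..k} \<subseteq> {1..k}" using ov unfolding overlaps_at_def by blast
  then have pre: "\<sigma> ` {1..k} = {1..k}" by (rule endo_inj_surj[OF finite_atLeastAtMost _ inj])
  have sub: "\<sigma> ` {n - k + 1..n} \<subseteq> {n - k + 1..n}"
    using overlap_conditions_iff_overlaps_at[OF inj, of k n] half ov by simp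
  have suf: "\<sigma> ` {n - k + 1..n} = {n - k + 1..n}"
    by (intro endo_inj_surj inj sub) simp
  have mid_eq: "{k + 1..n - k} = {1..n} - {1..k} - {n - k + 1..n}" using half by auto
  have mid: "\<sigma> ` {k + 1..n - k} = {k + 1..n - k}"
    unfolding mid_eq using permutes_inj[OF \<sigma>] pre suf permutes_image[OF \<sigma>]
    by (simp add: image_set_diff)
  show "restrict_id \<sigma> {1..k} permutes {1..k}"
    by (rule permutes_restrict_id) (use inj pre in \<open>unfold bij_betw_def, blast\<close>)
  show "restrict_id \<sigma> {k + 1..n - k} permutes {k + 1..n - k}"
    by (rule permutes_restrict_id) (use inj mid in \<open>unfold bij_betw_def, blast\<close>)
qed

lemma glue_restrict:
  assumes \<sigma>: "\<sigma> permutes {1..n}" and ov: "overlaps_at n k \<sigma>"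
  shows "glue n k (restrict_id \<sigma> {1..k}) (restrict_id \<sigma> {k + 1..n - k}) = \<sigma>"
proof
  fix x
  show "glue n k (restrict_id \<sigma> {1..k}) (restrict_id \<sigma> {k + 1..n - k}) x = \<sigma> x"
  proof (cases "x \<in> {1..n}")
    case True
    then show ?thesis
    proof (cases x rule: block_cases)
      case (suffix y)
      then show ?thesis using ov by (simp add: glue_suffix overlaps_at_def)
    qed (simp_all add: glue_prefix glue_middle)
  next
    case False
    then show ?thesis
      using permutes_not_in[OF \<sigma> False] by (simp add: glue_outside restrict_id_def)
  qed
qed

text \<open>
  Gluing is a bijection from pairs of a non-self-overlapping prefix and a permutation of
  the middle block; restricting to the two blocks is its inverse.
\<close>

lemma card_primitive_overlap:
  "card {\<sigma> \<in> Sym n. overlaps_at n k \<sigma> \<and> \<not> self_overlapping k \<sigma>} =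
     num_non_self_overlapping k * fact (n - 2 * k)"
proof -
  let ?N = "{\<tau> \<in> Sym k. \<not> self_overlapping k \<tau>}"
  let ?M = "{\<rho>. \<rho> permutes {k + 1..n - k}}"
  let ?B = "{\<sigma> \<in> Sym n. overlaps_at n k \<sigma> \<and> \<not> self_overlapping k \<sigma>}"
  have "bij_betw (\<lambda>(\<tau>, \<rho>). glue n k \<tau> \<rho>) (?N \<times> ?M) ?B"
  proof (rule bij_betw_byWitness
      [where f' = "\<lambda>\<sigma>. (restrict_id \<sigma> {1..k}, restrict_id \<sigma> {k + 1..n - k})"], goal_cases)
    case 1
    have "restrict_id (glue n k \<tau> \<rho>) {1..k} = \<tau>"
      if "\<tau> permutes {1..k}" for \<tau> \<rho>
      using permutes_not_in[OF that] by (auto simp: fun_eq_iff restrict_id_def glue_def)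
    moreover have "restrict_id (glue n k \<tau> \<rho>) {k + 1..n - k} = \<rho>"
      if "\<rho> permutes {k + 1..n - k}" for \<tau> \<rho>
      using permutes_not_in[OF that] half by (auto simp: fun_eq_iff restrict_id_def glue_def)
    ultimately show ?case by (auto simp: Sym_def)
  next
    case 2
    show ?case using glue_restrict by (auto simp: Sym_def)
  next
    case 3
    have "self_overlapping k (glue n k \<tau> \<rho>) \<longleftrightarrow> self_overlapping k \<tau>"
      if "\<tau> permutes {1..k}" for \<tau> \<rho>
      by (rule self_overlapping_cong) (auto simp: glue_def permutes_inj_on[OF that])
    then show ?case using glue_permutes overlaps_at_glue by (auto simp: Sym_def)
  next
    case 4
    have "self_overlapping k (restrict_id \<sigma> {1..k}) \<longleftrightarrow> self_overlapping k \<sigma>"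
      if "\<sigma> permutes {1..n}" for \<sigma>
      by (rule self_overlapping_cong) (auto simp: permutes_inj_on[OF that])
    then show ?case using restrict_blocks_permute by (auto simp: Sym_def)
  qed
  then have "card ?B = card (?N \<times> ?M)" by (simp add: bij_betw_same_card)
  also have "\<dots> = num_non_self_overlapping k * card ?M"
    by (simp add: card_cartesian_product num_non_self_overlapping_def)
  also have "card ?M = fact (n - 2 * k)"
    by (rule card_permutations) (use half in auto)
  finally show ?thesis .
qed

end

lemma card_self_overlapping:
  "card {\<sigma> \<in> Sym n. self_overlapping n \<sigma>} =
     (\<Sum>k = 1..n div 2. num_non_self_overlapping k * fact (n - 2 * k))"
proof -
  let ?B = "\<lambda>k. {\<sigma> \<in> Sym n. overlaps_at n k \<sigma> \<and> \<not> self_overlapping k \<sigma>}"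
  have inj: "inj_on \<sigma> {1..n}" if "\<sigma> \<in> Sym n" for \<sigma>
    using that permutes_inj_on by (auto simp: Sym_def)
  have "{\<sigma> \<in> Sym n. self_overlapping n \<sigma>} = (\<Union>k\<in>{1..n div 2}. ?B k)"
    using self_overlapping_iff_primitive_overlap[OF inj] by auto
  also have "card \<dots> = (\<Sum>k = 1..n div 2. card (?B k))"
  proof (rule card_UN_disjoint)
    show "\<forall>k\<in>{1..n div 2}. finite (?B k)"
      by (auto simp: Sym_def finite_permutations intro: finite_subset[of _ "{\<sigma>. \<sigma> permutes {1..n}}"])
    show "\<forall>j\<in>{1..n div 2}. \<forall>k\<in>{1..n div 2}. j \<noteq> k \<longrightarrow> ?B j \<inter> ?B k = {}"
    proof (intro ballI impI)
      fix j k assume jk: "j \<in> {1..n div 2}" "k \<in> {1..n div 2}" "j \<noteq> k"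
      have False if "\<sigma> \<in> ?B j" "\<sigma> \<in> ?B k" for \<sigma>
      proof -
        have "j \<le> n" "k \<le> n" using jk by auto
        then show False
          using primitive_overlap_unique[of \<sigma> n j k] inj[of \<sigma>] jk that by auto
      qed
      then show "?B j \<inter> ?B k = {}" by blast
    qed
  qed simp
  also have "\<dots> = (\<Sum>k = 1..n div 2. num_non_self_overlapping k * fact (n - 2 * k))"
    by (intro sum.cong card_primitive_overlap) auto
  finally show ?thesis .
qed

section \<open>Estimating the tail\<close>

lemma falling_factorial_eq_fact_quotient:
  "k \<le> n \<Longrightarrow> falling_factorial (real n) k = fact n / fact (n - k)"
proof (induction k)
  case (Suc k)
  have "(fact (n - k) :: real) = real (n - k) * fact (n - Suc k)"
    using Suc.prems by (metis Suc_diff_Suc Suc_le_lessD fact_Suc of_nat_mult of_nat_fact)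
  with Suc show ?case by (simp add: falling_factorial_def of_nat_diff)
qed (simp add: falling_factorial_def)

lemma falling_factorial_ge_half_power:
  assumes "2 * m \<le> n"
  shows "(real n / 2) ^ m \<le> falling_factorial (real n) m"
proof -
  have "(\<Prod>i<m. real n / 2) \<le> (\<Prod>i<m. real n - real i)"
    using assms by (intro prod_mono) auto
  then show ?thesis by (simp add: falling_factorial_def)
qed

lemma inverse_falling_factorial_le:
  assumes "2 * m \<le> n" "n > 0"
  shows "1 / falling_factorial (real n) m \<le> 2 ^ m / real n ^ m"
proof -
  have "1 / falling_factorial (real n) m \<le> 1 / (real n / 2) ^ m"
    using falling_factorial_ge_half_power[OF assms(1)] assms(2) by (intro frac_le) auto
  then show ?thesis by (simp add: power_divide)
qed

lemma prob_self_overlapping: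
  "measure_pmf.prob (pmf_of_set (Sym n)) {\<sigma>. self_overlapping n \<sigma>} =
     (\<Sum>k = 1..n div 2. real (num_non_self_overlapping k) / falling_factorial (real n) (2 * k))"
proof -
  have fin: "finite (Sym n)" and card: "card (Sym n) = fact n"
    by (auto simp: Sym_def finite_permutations card_permutations)
  have ne: "Sym n \<noteq> {}" using permutes_id unfolding Sym_def by blast
  have "measure_pmf.prob (pmf_of_set (Sym n)) {\<sigma>. self_overlapping n \<sigma>} =
    card {\<sigma> \<in> Sym n. self_overlapping n \<sigma>} / fact n"
    by (simp add: measure_pmf_of_set[OF ne fin] card Int_def)
  also have "\<dots> = (\<Sum>k = 1..n div 2. real (num_non_self_overlapping k) * fact (n - 2 * k) / fact n)"
    by (simp add: card_self_overlapping sum_divide_distrib)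
  also have "\<dots> = (\<Sum>k = 1..n div 2.
      real (num_non_self_overlapping k) / falling_factorial (real n) (2 * k))"
    by (intro sum.cong refl) (auto simp: falling_factorial_eq_fact_quotient)
  finally show ?thesis .
qed

lemma num_non_self_overlapping_le_fact: "num_non_self_overlapping k \<le> fact k"
proof -
  have "num_non_self_overlapping k \<le> card (Sym k)"
    unfolding num_non_self_overlapping_def
    by (intro card_mono) (auto simp: Sym_def finite_permutations)
  then show ?thesis by (simp add: Sym_def card_permutations)
qed

text \<open>
  The condition \<open>4 * k \<le> n\<close> keeps all \<open>2 * k\<close> factors of the falling factorial at least
  \<open>n / 2\<close>, at the cost of a factor \<open>4 ^ k\<close>; this is harmless as long as \<open>k\<close> is bounded.
\<close>

lemma summand_le_of_le_quarter:
  assumes "r \<le> k" "4 * k \<le> n" "n > 0"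
  shows "real (num_non_self_overlapping k) / falling_factorial (real n) (2 * k)
    \<le> fact k * 4 ^ k / real n ^ (2 * r)"
proof -
  have "real (num_non_self_overlapping k) * (1 / falling_factorial (real n) (2 * k))
    \<le> fact k * (2 ^ (2 * k) / real n ^ (2 * k))"
  proof (rule mult_mono)
    show "real (num_non_self_overlapping k) \<le> fact k"
      using num_non_self_overlapping_le_fact[of k] by (metis of_nat_fact of_nat_le_iff)
  qed (use assms inverse_falling_factorial_le[of "2 * k" n]
        falling_factorial_eq_fact_quotient[of "2 * k" n] in auto)
  also have "\<dots> = fact k * 4 ^ k / real n ^ (2 * k)" by (simp add: power_mult)
  also have "\<dots> \<le> fact k * 4 ^ k / real n ^ (2 * r)"
    using assms by (intro divide_left_mono power_increasing) auto
  finally show ?thesis by simp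
qed

text \<open>
  Since \<open>k! (n - 2k)!\<close> divides \<open>(n - k)!\<close>, the term for \<open>k\<close> is at most \<open>(n - k)! / n!\<close>, which
  decreases in \<open>k\<close>. Unlike the previous bound this one has no constant growing with \<open>k\<close>.
\<close>

lemma summand_le_inverse_falling_factorial:
  assumes "m \<le> k" "2 * k \<le> n"
  shows "real (num_non_self_overlapping k) / falling_factorial (real n) (2 * k)
    \<le> 1 / falling_factorial (real n) m"
proof -
  have "num_non_self_overlapping k * fact (n - 2 * k) \<le> fact k * fact (n - 2 * k)"
    by (simp add: num_non_self_overlapping_le_fact)
  also have "\<dots> \<le> (fact (k + (n - 2 * k)) :: nat)"
    by (intro dvd_imp_le fact_fact_dvd_fact) simp
  also have "\<dots> \<le> fact (n - m)" using assms by (intro fact_mono) auto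
  finally have "real (num_non_self_overlapping k) * fact (n - 2 * k) \<le> fact (n - m)"
    by (metis of_nat_fact of_nat_le_iff of_nat_mult)
  then have "real (num_non_self_overlapping k) * fact (n - 2 * k) / fact n \<le> fact (n - m) / fact n"
    by (intro divide_right_mono) auto
  then show ?thesis using assms by (simp add: falling_factorial_eq_fact_quotient)
qed

lemma tail_sum_le:
  assumes n: "8 * r + 2 \<le> n"
  shows "(\<Sum>k = r..n div 2. real (num_non_self_overlapping k) / falling_factorial (real n) (2 * k))
    \<le> ((\<Sum>k = r..2 * r. fact k * 4 ^ k) + 2 ^ (2 * r + 1)) / real n ^ (2 * r)"
proof -
  let ?t = "\<lambda>k. real (num_non_self_overlapping k) / falling_factorial (real n) (2 * k)"
  \<comment> \<open>Beyond \<open>2 * r\<close> every term gains a power of \<open>n\<close>, enough to sum up to \<open>n\<close> of them.\<close>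
  have "{r..n div 2} = {r..2 * r} \<union> {2 * r + 1..n div 2}" using n by auto
  then have "sum ?t {r..n div 2} = sum ?t {r..2 * r} + sum ?t {2 * r + 1..n div 2}"
    by (simp add: sum.union_disjoint)
  moreover have "sum ?t {r..2 * r} \<le> (\<Sum>k = r..2 * r. fact k * 4 ^ k / real n ^ (2 * r))"
    using n by (intro sum_mono summand_le_of_le_quarter) auto
  moreover have "sum ?t {2 * r + 1..n div 2} \<le> 2 ^ (2 * r + 1) / real n ^ (2 * r)"
  proof -
    have "?t k \<le> 2 ^ (2 * r + 1) / real n ^ (2 * r + 1)" if "k \<in> {2 * r + 1..n div 2}" for k
    proof -
      have "?t k \<le> 1 / falling_factorial (real n) (2 * r + 1)"
        using that by (intro summand_le_inverse_falling_factorial) auto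
      also have "\<dots> \<le> 2 ^ (2 * r + 1) / real n ^ (2 * r + 1)"
        using n by (intro inverse_falling_factorial_le) auto
      finally show ?thesis .
    qed
    then have "sum ?t {2 * r + 1..n div 2} \<le>
        real (card {2 * r + 1..n div 2}) * (2 ^ (2 * r + 1) / real n ^ (2 * r + 1))"
      by (rule sum_bounded_above)
    also have "\<dots> \<le> real n * (2 ^ (2 * r + 1) / real n ^ (2 * r + 1))"
      by (intro mult_right_mono) auto
    also have "\<dots> = 2 ^ (2 * r + 1) / real n ^ (2 * r)" using n by simp
    finally show ?thesis .
  qed
  ultimately show ?thesis by (simp add: add_divide_distrib sum_divide_distrib)
qed

theorem theorem3p1:
  fixes r :: nat
  assumes "r \<ge> 1"
  shows "(\<lambda>n. measure_pmf.prob (pmf_of_set (Sym n)) {\<sigma>. self_overlapping n \<sigma>}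
              - (\<Sum>k = 1..r - 1. real (num_non_self_overlapping k)
                                / falling_factorial (real n) (2 * k)))
         \<in> O(\<lambda>n::nat. 1 / real n ^ (2 * r))"
proof (rule bigoI[OF eventually_sequentiallyI])
  fix n :: nat assume n: "8 * r + 2 \<le> n"
  let ?t = "\<lambda>k. real (num_non_self_overlapping k) / falling_factorial (real n) (2 * k)"
  let ?c = "(\<Sum>k = r..2 * r. fact k * 4 ^ k) + 2 ^ (2 * r + 1) :: real"
  have "{1..n div 2} = {1..r - 1} \<union> {r..n div 2}" using n assms by auto
  then have "sum ?t {1..n div 2} = sum ?t {1..r - 1} + sum ?t {r..n div 2}"
    using assms by (simp add: sum.union_disjoint)
  moreover have "0 \<le> sum ?t {r..n div 2}"
    by (intro sum_nonneg) (auto simp: falling_factorial_eq_fact_quotient)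
  ultimately show "norm (measure_pmf.prob (pmf_of_set (Sym n)) {\<sigma>. self_overlapping n \<sigma>}
      - sum ?t {1..r - 1}) \<le> ?c * norm (1 / real n ^ (2 * r))"
    using tail_sum_le[OF n] by (simp add: prob_self_overlapping)
qed

end
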